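(* For every finite simple connected graph $G=(V,E)$ and every integer $t\ge0$ (not necessarily smaller than $\kappa(G)$), local consensus in $G$ can be solved by an oblivious algorithm running in $\mathrm{radius}(G,t)$ rounds under the $t$-resilient model, where $\mathrm{radius}(G,t)=\min_{v\in V}\mathrm{ecc}(v,\Omega^{(t)}_{\mathrm{all}})$.
   Context: Model. $G=(V,E)$ is a finite simple connected undirected graph with distinct node identifiers; $N(v)$ is the neighbourhood of $v$. Synchronous rounds; each node sends to every neighbour, receives, and computes in each round; nodes know $G$ and $t$. Failure patterns. A failure pattern is a set $\varphi=\{(v,F_v,f_v): v\in F\}$ with $F\subseteq V$, $|F|\le t$, integers $f_v\ge1$ and nonempty $F_v\subseteq N(v)$: $v$ acts normally in rounds $<f_v$, in round $f_v$ its messages reach exactly $N(v)\setminus F_v$, afterwards it sends nothing. Nodes in $F$ are faulty, others correct. $\Phi^{(t)}_{\mathrm{all}}$ is the set of failure patterns with at most $t$ faulty nodes. $\mathrm{comp}(G,\varphi)$ is the set of connected components of the subgraph of $G$ induced by the correct nodes of $\varphi$. Causal paths and views. A causal path w.r.t. $\varphi$ from $v$ to $v'$ is $u_1=v,\dots,u_q=v'$ with $u_{i+1}\in N(u_i)$, $u_i$ not crashed during rounds $1,\dots,i-1$, and $u_{i+1}\notin F_{u_i}$ if $u_i$ crashes at round $i$; length $q-1$. With inputs $x_u$ and flooding (each node sends $(u,x_u)$ in round 1, forwards all known pairs afterwards), $\mathrm{view}(v,r,\varphi)$ is the set of pairs $(u,x_u)$ with $u=v$ or with a causal path w.r.t.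 $\varphi$ of length at most $r$ from $u$ to $v$. Eccentricity and radius beyond connectivity. For $C\in\mathrm{comp}(G,\varphi)$, $\mathrm{ecc}(v,\varphi,C)$ is the maximum over $w\in C$ of the minimum length of a causal path w.r.t. $\varphi$ from $v$ to $w$, and is $\infty$ if some $w\in C$ has no such path. $\Omega^{(t)}_{\mathrm{all}}=\{(\varphi,C):\varphi\in\Phi^{(t)}_{\mathrm{all}},\ C\in\mathrm{comp}(G,\varphi)\}$; for $\Omega\subseteq\Omega^{(t)}_{\mathrm{all}}$, $\mathrm{ecc}(v,\Omega)=\max\{\mathrm{ecc}(v,\varphi,C):(\varphi,C)\in\Omega,\ \mathrm{ecc}(v,\varphi,C)<\infty\}$. Oblivious algorithm. An oblivious algorithm running in $r$ rounds floods for $r$ rounds, then each correct node $v$ outputs a value depending only on $v$ and $\mathrm{view}(v,r,\varphi)$. Local consensus. Every node $v$ has an input $x_v$ and every correct node $v$ must output $y_v$ such that (1) for every failure pattern $\varphi$, every $C\in\mathrm{comp}(G,\varphi)$, and all $u,v\in C$, $y_u=y_v$; and (2) for every correct $v$ there is $u\in V$ with $y_v=x_u$. *)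

theory Defs
  imports Main "HOL-Library.Extended_Nat"
begin

section \<open>Graphs\<close>

text \<open>A finite simple undirected graph on vertex set V with edge relation E.
  Node identifiers are the vertices themselves (hence distinct).\<close>

definition simple_graph :: "'v set \<Rightarrow> ('v \<Rightarrow> 'v \<Rightarrow> bool) \<Rightarrow> bool" where
  "simple_graph V E \<longleftrightarrow> finite V \<and> (\<forall>u w. E u w \<longrightarrow> u \<in> V \<and> w \<in> V)
     \<and> (\<forall>u w. E u w \<longrightarrow> E w u) \<and> (\<forall>u. \<not> E u u)"

definition graph_connected :: "'v set \<Rightarrow> ('v \<Rightarrow> 'v \<Rightarrow> bool) \<Rightarrow> bool" where
  "graph_connected V E \<longleftrightarrow> V \<noteq> {} \<and> (\<forall>u\<in>V. \<forall>w\<in>V. (u, w) \<in> {(a, b). E a b}\<^sup>*)"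

definition nbrs :: "'v set \<Rightarrow> ('v \<Rightarrow> 'v \<Rightarrow> bool) \<Rightarrow> 'v \<Rightarrow> 'v set" where
  "nbrs V E v = {u \<in> V. E v u}"

section \<open>Failure patterns\<close>

text \<open>A failure pattern is encoded as a partial map: \<open>\<phi> v = Some (F_v, f_v)\<close> iff v is faulty,
  crashing in round \<open>f_v\<close>, with its round-\<open>f_v\<close> messages NOT reaching the nodes of \<open>F_v\<close>.\<close>

type_synonym 'v fpattern = "'v \<Rightarrow> ('v set \<times> nat) option"

definition faulty :: "'v fpattern \<Rightarrow> 'v set" where
  "faulty \<phi> = dom \<phi>"

definition failure_pattern :: "'v set \<Rightarrow> ('v \<Rightarrow> 'v \<Rightarrow> bool) \<Rightarrow> nat \<Rightarrow> 'v fpattern \<Rightarrow> bool" where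
  "failure_pattern V E t \<phi> \<longleftrightarrow> faulty \<phi> \<subseteq> V \<and> card (faulty \<phi>) \<le> t \<and>
     (\<forall>v Fv fv. \<phi> v = Some (Fv, fv) \<longrightarrow> fv \<ge> 1 \<and> Fv \<noteq> {} \<and> Fv \<subseteq> nbrs V E v)"

text \<open>Connected components of the subgraph induced by the correct nodes.\<close>

definition comp :: "'v set \<Rightarrow> ('v \<Rightarrow> 'v \<Rightarrow> bool) \<Rightarrow> 'v fpattern \<Rightarrow> 'v set set" where
  "comp V E \<phi> = (let S = V - faulty \<phi> in
     {C. \<exists>u\<in>S. C = {w \<in> S. (u, w) \<in> (Restr {(a, b). E a b} S)\<^sup>*}})"

section \<open>Causal paths, views, eccentricity\<close>

text \<open>Node u may send a message that is received by w in round i (i \<ge> 1):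
  u has not crashed during rounds 1..i-1, and if it crashes in round i then w \<notin> F_u.\<close>

definition sends_ok :: "'v fpattern \<Rightarrow> 'v \<Rightarrow> nat \<Rightarrow> 'v \<Rightarrow> bool" where
  "sends_ok \<phi> u i w = (case \<phi> u of None \<Rightarrow> True
                         | Some (Fu, fu) \<Rightarrow> i < fu \<or> (i = fu \<and> w \<notin> Fu))"

text \<open>A causal path is a nonempty list \<open>ps = [u_1, ..., u_q]\<close> (0-indexed here: \<open>ps!i = u_(i+1)\<close>),
  whose i-th hop is performed in round i+1. Its length is \<open>length ps - 1\<close>.\<close>

definition causal_path :: "'v set \<Rightarrow> ('v \<Rightarrow> 'v \<Rightarrow> bool) \<Rightarrow> 'v fpattern \<Rightarrow> 'v list \<Rightarrow> bool" where
  "causal_path V E \<phi> ps \<longleftrightarrow> ps \<noteq> [] \<and>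
     (\<forall>i. i + 1 < length ps \<longrightarrow>
        ps ! (i + 1) \<in> nbrs V E (ps ! i) \<and> sends_ok \<phi> (ps ! i) (i + 1) (ps ! (i + 1)))"

definition view :: "'v set \<Rightarrow> ('v \<Rightarrow> 'v \<Rightarrow> bool) \<Rightarrow> 'v fpattern \<Rightarrow> ('v \<Rightarrow> 'x) \<Rightarrow> 'v \<Rightarrow> nat
                     \<Rightarrow> ('v \<times> 'x) set" where
  "view V E \<phi> x v r = {(u, x u) | u. u = v \<or>
      (\<exists>ps. causal_path V E \<phi> ps \<and> hd ps = u \<and> last ps = v \<and> length ps - 1 \<le> r)}"

text \<open>Minimum causal-path length from v to w (\<open>\<infinity>\<close> if there is none).\<close>

definition cdist :: "'v set \<Rightarrow> ('v \<Rightarrow> 'v \<Rightarrow> bool) \<Rightarrow> 'v fpattern \<Rightarrow> 'v \<Rightarrow> 'v \<Rightarrow> enat" where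
  "cdist V E \<phi> v w = (INF ps \<in> {ps. causal_path V E \<phi> ps \<and> hd ps = v \<and> last ps = w}.
                         enat (length ps - 1))"

definition ecc :: "'v set \<Rightarrow> ('v \<Rightarrow> 'v \<Rightarrow> bool) \<Rightarrow> 'v fpattern \<Rightarrow> 'v \<Rightarrow> 'v set \<Rightarrow> enat" where
  "ecc V E \<phi> v C = (SUP w \<in> C. cdist V E \<phi> v w)"

definition Omega_all :: "'v set \<Rightarrow> ('v \<Rightarrow> 'v \<Rightarrow> bool) \<Rightarrow> nat \<Rightarrow> ('v fpattern \<times> 'v set) set" where
  "Omega_all V E t = {(\<phi>, C). failure_pattern V E t \<phi> \<and> C \<in> comp V E \<phi>}"

text \<open>\<open>ecc(v, \<Omega>)\<close>: maximum of the finite eccentricities over \<open>\<Omega>\<close>.\<close>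

definition ecc_set :: "'v set \<Rightarrow> ('v \<Rightarrow> 'v \<Rightarrow> bool) \<Rightarrow> ('v fpattern \<times> 'v set) set \<Rightarrow> 'v \<Rightarrow> nat" where
  "ecc_set V E \<Omega> v = Max {n. \<exists>(\<phi>, C) \<in> \<Omega>. ecc V E \<phi> v C = enat n}"

definition radius :: "'v set \<Rightarrow> ('v \<Rightarrow> 'v \<Rightarrow> bool) \<Rightarrow> nat \<Rightarrow> nat" where
  "radius V E t = Min ((\<lambda>v. ecc_set V E (Omega_all V E t) v) ` V)"

section \<open>Oblivious algorithms and local consensus\<close>

text \<open>An oblivious algorithm is a decision map \<open>dec\<close>: correct node v outputs
  \<open>dec v (view v r \<phi>)\<close>. It may depend on G and t (fixed before it is chosen),
  but not on the inputs or the failure pattern.\<close>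

definition oblivious_solves_local_consensus ::
  "'v set \<Rightarrow> ('v \<Rightarrow> 'v \<Rightarrow> bool) \<Rightarrow> nat \<Rightarrow> nat \<Rightarrow> ('v \<Rightarrow> ('v \<times> 'x) set \<Rightarrow> 'x) \<Rightarrow> bool" where
  "oblivious_solves_local_consensus V E t r dec \<longleftrightarrow>
     (\<forall>(x :: 'v \<Rightarrow> 'x) \<phi>. failure_pattern V E t \<phi> \<longrightarrow>
        (\<forall>C \<in> comp V E \<phi>. \<forall>u \<in> C. \<forall>v \<in> C.
            dec u (view V E \<phi> x u r) = dec v (view V E \<phi> x v r)) \<and>
        (\<forall>v \<in> V - faulty \<phi>. \<exists>u \<in> V. dec v (view V E \<phi> x v r) = x u))"

end

theory Submission
  imports Defs
begin

text \<open>Enumerate \<open>V\<close> starting with a node \<open>v\<close> of minimum eccentricity \<open>r\<close> so that all initial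
  segments are connected, and let every node output the input of the first node of the
  enumeration in its view. Correct nodes of a component \<open>C\<close> forward everything they hear, so a
  node reaches either all or none of \<open>C\<close>; it remains to see that the first enumerated node \<open>b\<close>
  that reaches \<open>C\<close> does so within \<open>r\<close> rounds. Let \<open>S\<close> be the set of its predecessors, none of
  which reaches \<open>C\<close>, and \<open>P\<close> a shortest causal path from \<open>b\<close> to some \<open>w \<in> C\<close>. Keep the set of
  faulty nodes, but let each of them relay the information of \<open>v\<close> only inside \<open>S \<union> {b}\<close> or
  along \<open>P\<close>, and crash afterwards. Then \<open>v\<close> reaches \<open>C\<close>, but reaches \<open>w\<close> no sooner than \<open>b\<close> did:
  a shortcut onto \<open>P\<close> would have let a node of \<open>S\<close> reach \<open>C\<close> in the original pattern. As \<open>v\<close>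
  has eccentricity at most \<open>r\<close> in the new pattern, \<open>P\<close> has length at most \<open>r\<close>.\<close>

section \<open>Causal reachability in a given number of rounds\<close>

text \<open>The length is exact rather than bounded, since it determines the round of the next hop:
  after \<open>n\<close> hops this is round \<open>n + 1\<close>.\<close>

definition creach :: "'v set \<Rightarrow> ('v \<Rightarrow> 'v \<Rightarrow> bool) \<Rightarrow> 'v fpattern \<Rightarrow> 'v \<Rightarrow> nat \<Rightarrow> 'v \<Rightarrow> bool" where
  "creach V E \<phi> u n w \<longleftrightarrow>
     (\<exists>ps. causal_path V E \<phi> ps \<and> hd ps = u \<and> last ps = w \<and> length ps = Suc n)"

lemma causal_path_snoc:
  assumes "ps \<noteq> []"
  shows "causal_path V E \<phi> (ps @ [w]) \<longleftrightarrow>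
    causal_path V E \<phi> ps \<and> w \<in> nbrs V E (last ps) \<and> sends_ok \<phi> (last ps) (length ps) w"
    (is "?L \<longleftrightarrow> ?R")
proof
  assume L: ?L
  have "ps ! (i + 1) \<in> nbrs V E (ps ! i) \<and> sends_ok \<phi> (ps ! i) (i + 1) (ps ! (i + 1))"
    if "i + 1 < length ps" for i
    using L that unfolding causal_path_def by (auto simp: nth_append dest!: spec[of _ i])
  moreover have "w \<in> nbrs V E (last ps) \<and> sends_ok \<phi> (last ps) (length ps) w"
    using L assms unfolding causal_path_def
    by (auto simp: nth_append last_conv_nth dest!: spec[of _ "length ps - 1"])
  ultimately show ?R using assms unfolding causal_path_def by blast
next
  assume R: ?R
  show ?L unfolding causal_path_def
  proof (intro conjI allI impI)
    fix i assume i: "i + 1 < length (ps @ [w])"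
    have "i + 1 < length ps \<or> i = length ps - 1" using i by auto
    then show "(ps @ [w]) ! (i + 1) \<in> nbrs V E ((ps @ [w]) ! i)"
      and "sends_ok \<phi> ((ps @ [w]) ! i) (i + 1) ((ps @ [w]) ! (i + 1))"
      using R assms by (auto simp: causal_path_def nth_append last_conv_nth)
  qed simp
qed

lemma creach_0 [simp]: "creach V E \<phi> u 0 w \<longleftrightarrow> w = u"
proof
  assume "creach V E \<phi> u 0 w"
  then show "w = u" by (auto simp: creach_def length_Suc_conv)
next
  assume "w = u"
  then show "creach V E \<phi> u 0 w"
    by (auto simp: creach_def causal_path_def intro!: exI[of _ "[u]"])
qed

lemma creach_Suc:
  "creach V E \<phi> u (Suc n) w \<longleftrightarrow>
     (\<exists>y. creach V E \<phi> u n y \<and> w \<in> nbrs V E y \<and> sends_ok \<phi> y (Suc n) w)" (is "?L \<longleftrightarrow> ?R")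
proof
  assume ?L
  then obtain ps where ps: "causal_path V E \<phi> ps" "hd ps = u" "last ps = w"
    "length ps = Suc (Suc n)" by (auto simp: creach_def)
  define qs where "qs = butlast ps"
  have "ps = qs @ [w]" "qs \<noteq> []" "length qs = Suc n"
    using ps by (auto simp: qs_def length_Suc_conv butlast_append)
  then show ?R using ps causal_path_snoc[of qs V E \<phi> w]
    unfolding creach_def by (auto intro!: exI[of _ "last qs"] exI[of _ qs])
next
  assume ?R
  then obtain ps y where ps: "causal_path V E \<phi> ps" "hd ps = u" "last ps = y"
    "length ps = Suc n" "w \<in> nbrs V E y" "sends_ok \<phi> y (Suc n) w" by (auto simp: creach_def)
  then have "ps \<noteq> []" by auto
  with ps show ?L unfolding creach_def
    by (intro exI[of _ "ps @ [w]"]) (auto simp: causal_path_snoc)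
qed

lemma causal_path_le_iff:
  "(\<exists>ps. causal_path V E \<phi> ps \<and> hd ps = u \<and> last ps = w \<and> length ps - 1 \<le> r)
     \<longleftrightarrow> (\<exists>m\<le>r. creach V E \<phi> u m w)"
proof
  assume "\<exists>ps. causal_path V E \<phi> ps \<and> hd ps = u \<and> last ps = w \<and> length ps - 1 \<le> r"
  then obtain ps where ps: "causal_path V E \<phi> ps" "hd ps = u" "last ps = w" "length ps - 1 \<le> r"
    by blast
  then have "length ps = Suc (length ps - 1)" by (cases ps) (auto simp: causal_path_def)
  then have "creach V E \<phi> u (length ps - 1) w" using ps unfolding creach_def by blast
  then show "\<exists>m\<le>r. creach V E \<phi> u m w" using ps(4) by blast
qed (auto simp: creach_def)

lemma cdist_le_iff: "cdist V E \<phi> v w \<le> enat n \<longleftrightarrow> (\<exists>m\<le>n. creach V E \<phi> v m w)"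
proof -
  have "cdist V E \<phi> v w \<le> enat n \<longleftrightarrow> cdist V E \<phi> v w < enat (Suc n)"
    by (cases "cdist V E \<phi> v w") auto
  also have "\<dots> \<longleftrightarrow> (\<exists>ps. causal_path V E \<phi> ps \<and> hd ps = v \<and> last ps = w \<and> length ps - 1 \<le> n)"
    unfolding cdist_def INF_less_iff by (auto simp: less_Suc_eq_le)
  finally show ?thesis unfolding causal_path_le_iff .
qed

lemma mem_view_iff:
  "(u, y) \<in> view V E \<phi> x v r \<longleftrightarrow> y = x u \<and> (\<exists>m\<le>r. creach V E \<phi> u m v)"
proof -
  have "u = v \<Longrightarrow> \<exists>m\<le>r. creach V E \<phi> u m v" by (intro exI[of _ 0]) simp
  then show ?thesis unfolding view_def mem_Collect_eq causal_path_le_iff by blast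
qed

lemma sends_ok_antimono: "sends_ok \<phi> u i w \<Longrightarrow> j \<le> i \<Longrightarrow> sends_ok \<phi> u j w"
  by (auto simp: sends_ok_def split: option.splits)

lemma sends_ok_correct: "u \<notin> faulty \<phi> \<Longrightarrow> sends_ok \<phi> u i w"
  by (cases "\<phi> u") (auto simp: sends_ok_def faulty_def)

lemma creach_path:
  assumes "creach V E \<phi> u n w"
  obtains p where "p 0 = u" "p n = w"
    "\<And>i. i < n \<Longrightarrow> p (Suc i) \<in> nbrs V E (p i) \<and> sends_ok \<phi> (p i) (Suc i) (p (Suc i))"
proof -
  from assms obtain ps where ps: "causal_path V E \<phi> ps" "hd ps = u" "last ps = w"
    "length ps = Suc n" by (auto simp: creach_def)
  then have "ps \<noteq> []" by auto
  with ps show ?thesis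
    by (intro that[of "(!) ps"]) (auto simp: hd_conv_nth last_conv_nth causal_path_def)
qed

text \<open>Joining a causal path earlier than its own source does is harmless, since messages that
  are sent earlier are delivered a fortiori.\<close>

lemma creach_join:
  assumes p: "\<And>i. i < n \<Longrightarrow> p (Suc i) \<in> nbrs V E (p i) \<and> sends_ok \<phi> (p i) (Suc i) (p (Suc i))"
    and s: "creach V E \<phi> s m (p i)" and "m \<le> i" "i \<le> j" "j \<le> n"
  shows "creach V E \<phi> s (m + (j - i)) (p j)"
  using \<open>i \<le> j\<close> \<open>j \<le> n\<close>
proof (induction j rule: dec_induct)
  case base
  then show ?case using s by simp
next
  case (step k)
  then have "creach V E \<phi> s (m + (k - i)) (p k)" by simp
  moreover have "sends_ok \<phi> (p k) (Suc (m + (k - i))) (p (Suc k))"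
    using p[of k] step \<open>m \<le> i\<close> by (auto intro: sends_ok_antimono)
  moreover have "m + (Suc k - i) = Suc (m + (k - i))" using step by simp
  ultimately show ?case using p[of k] step by (auto simp: creach_Suc)
qed

text \<open>A shortest causal path repeats no node: cutting out a loop only moves later hops to
  earlier rounds. The bound serves to make the set of finite eccentricities finite.\<close>

lemma creach_le_card:
  assumes "finite V" "u \<in> V" "creach V E \<phi> u k w"
  shows "\<exists>m\<le>card V. creach V E \<phi> u m w"
proof -
  define n where "n = (LEAST n. creach V E \<phi> u n w)"
  have n: "creach V E \<phi> u n w" using assms(3) unfolding n_def by (rule LeastI)
  have least: "n \<le> m" if "creach V E \<phi> u m w" for m using that unfolding n_def by (rule Least_le)
  from n obtain p where p: "p 0 = u" "p n = w"
    "\<And>i. i < n \<Longrightarrow> p (Suc i) \<in> nbrs V E (p i) \<and> sends_ok \<phi> (p i) (Suc i) (p (Suc i))"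
    by (rule creach_path) blast
  have at: "creach V E \<phi> u i (p i)" if "i \<le> n" for i
    using creach_join[OF p(3), of n u 0 0 i] p(1) that by simp
  have "p i \<noteq> p j" if "i < j" "j \<le> n" for i j
    using creach_join[OF p(3), of n u i j n] at[of i] least[of "i + (n - j)"] that p(2) by force
  then have "inj_on p {..n}" by (metis atMost_iff inj_onI linorder_neqE_nat)
  moreover have "p ` {..n} \<subseteq> V"
  proof
    fix y assume "y \<in> p ` {..n}"
    then obtain i where "i \<le> n" "y = p i" by auto
    then show "y \<in> V" using p(1) p(3)[of "i - 1"] \<open>u \<in> V\<close> by (cases i) (auto simp: nbrs_def)
  qed
  ultimately have "card {..n} \<le> card V" using \<open>finite V\<close> by (metis card_inj_on_le)
  then show ?thesis using n by (intro exI[of _ n]) auto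
qed

lemma comp_subset: "C \<in> comp V E \<phi> \<Longrightarrow> C \<subseteq> V - faulty \<phi>"
  by (auto simp: comp_def Let_def)

text \<open>Correct nodes send in every round, so a causal path that ends in \<open>C\<close>
  extends along walks inside \<open>C\<close>, however late it arrives.\<close>

lemma creach_comp:
  assumes "simple_graph V E" "C \<in> comp V E \<phi>" "w \<in> C" "w' \<in> C" "creach V E \<phi> u n w"
  shows "\<exists>m. creach V E \<phi> u m w'"
proof -
  define A where "A = Restr {(a, b). E a b} (V - faulty \<phi>)"
  have "sym (A\<^sup>*)" using assms(1) by (intro sym_rtrancl) (auto simp: A_def sym_def simple_graph_def)
  then have "(w, w') \<in> A\<^sup>*" using assms(2-4)
    unfolding comp_def Let_def A_def[symmetric] by (auto dest: symD intro: rtrancl_trans)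
  then show ?thesis
  proof (induction rule: rtrancl_induct)
    case base
    then show ?case using assms(5) by blast
  next
    case (step y z)
    then obtain m where "creach V E \<phi> u m y" by blast
    then have "creach V E \<phi> u (Suc m) z" using step(2)
      by (auto simp: creach_Suc A_def nbrs_def intro: sends_ok_correct)
    then show ?case by blast
  qed
qed

section \<open>Failure patterns that slow down a source\<close>

text \<open>A faulty node crashes in the round in which it would first relay the information of
  \<open>v\<close>. The set \<open>F\<^sub>v\<close> of a failure pattern must be nonempty, so a node that relays to all
  its neighbours crashes silently one round later.\<close>

lemma relay_pattern:
  assumes fp: "failure_pattern V E t \<phi>"
    and sub: "\<And>y z. (y, z) \<in> H \<Longrightarrow> z \<in> nbrs V E y"
    and correct: "\<And>y z. y \<notin> faulty \<phi> \<Longrightarrow> z \<in> nbrs V E y \<Longrightarrow> (y, z) \<in> H"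
  obtains \<psi> where "failure_pattern V E t \<psi>" "faulty \<psi> = faulty \<phi>"
    "\<And>n y. creach V E \<psi> v n y \<Longrightarrow> \<exists>m\<le>n. (v, y) \<in> H ^^ m"
    "\<And>y. (v, y) \<in> H\<^sup>* \<Longrightarrow> \<exists>n. creach V E \<psi> v n y"
proof -
  \<comment> \<open>The distance from \<open>v\<close> in \<open>H\<close>; an unspecified number if
    \<open>y\<close> is unreachable, where \<open>Suc\<close> still keeps the crash round
    positive.\<close>
  define D where "D y = (LEAST n. (v, y) \<in> H ^^ n)" for y
  define \<psi> where "\<psi> y = (if y \<in> faulty \<phi> then
     Some (if nbrs V E y \<subseteq> H `` {y} then (nbrs V E y, Suc (Suc (D y)))
           else (nbrs V E y - H `` {y}, Suc (D y))) else None)" for y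
  have faulty: "faulty \<psi> = faulty \<phi>" by (auto simp: faulty_def \<psi>_def dom_def)
  have ne: "nbrs V E y \<noteq> {}" if "y \<in> faulty \<phi>" for y
    using fp that unfolding failure_pattern_def faulty_def by fastforce
  have D_le: "D y \<le> n" if "(v, y) \<in> H ^^ n" for y n using that unfolding D_def by (rule Least_le)
  have D: "(v, y) \<in> H ^^ D y" if "(v, y) \<in> H ^^ n" for y n using that unfolding D_def by (rule LeastI)
  \<comment> \<open>Before round \<open>D y + 1\<close> a faulty \<open>y\<close> sends to everyone,
    but no causal path from \<open>v\<close> has arrived yet; from that round on only edges of
    \<open>H\<close> deliver.\<close>
  have late: "(y, z) \<in> H" if "z \<in> nbrs V E y" "sends_ok \<psi> y (Suc n) z" "D y \<le> n" for y z n
    using that correct[of y z] by (auto simp: sends_ok_def \<psi>_def split: if_splits)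
  have relay: "sends_ok \<psi> y (Suc (D y)) z" if "(y, z) \<in> H" for y z
    using that by (auto simp: sends_ok_def \<psi>_def)
  show ?thesis
  proof (rule that)
    show "failure_pattern V E t \<psi>" unfolding failure_pattern_def faulty
      using fp ne by (auto simp: failure_pattern_def \<psi>_def split: if_splits)
    show "faulty \<psi> = faulty \<phi>" by (fact faulty)
    show "\<exists>m\<le>n. (v, y) \<in> H ^^ m" if "creach V E \<psi> v n y" for n y
      using that
    proof (induction n arbitrary: y)
      case 0
      then show ?case by simp
    next
      case (Suc n)
      then obtain z m where z: "y \<in> nbrs V E z" "sends_ok \<psi> z (Suc n) y" "m \<le> n" "(v, z) \<in> H ^^ m"
        unfolding creach_Suc by blast
      then have "(z, y) \<in> H" using late D_le le_trans by metis
      with z show ?case by (intro exI[of _ "Suc m"]) auto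
    qed
    \<comment> \<open>Only walks of minimal length are claimed to be causal: a faulty node reached
      after more than \<open>D y\<close> rounds can no longer relay.\<close>
    have "creach V E \<psi> v n y" if "(v, y) \<in> H ^^ n" "D y = n" for n y
      using that
    proof (induction n arbitrary: y)
      case 0
      then show ?case by simp
    next
      case (Suc n)
      then obtain z where z: "(v, z) \<in> H ^^ n" "(z, y) \<in> H" by auto
      have "(v, y) \<in> H ^^ Suc (D z)" using D[OF z(1)] z(2) by auto
      then have "D z = n" using D_le[of y "Suc (D z)"] D_le[OF z(1)] Suc.prems by simp
      with z Suc.IH[of z] relay[OF z(2)] sub show ?case by (auto simp: creach_Suc)
    qed
    then show "\<exists>n. creach V E \<psi> v n y" if "(v, y) \<in> H\<^sup>*" for y
      using that D by (metis rtrancl_power)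
  qed
qed

text \<open>Whatever \<open>v\<close> reaches in \<open>n\<close> steps of the new relay relation,
  \<open>b\<close> or some node of \<open>S\<close> reaches within \<open>n\<close> rounds under
  \<open>\<phi>\<close>. For \<open>w\<close> that node can only be \<open>b\<close>, which needs
  \<open>R\<close> rounds.\<close>

lemma slower_pattern:
  assumes gr: "simple_graph V E" and fp: "failure_pattern V E t \<phi>"
    and "v \<in> S" and S: "\<And>s n. s \<in> S \<Longrightarrow> \<not> creach V E \<phi> s n w"
    and conn: "(v, b) \<in> {(a, c). E a c \<and> a \<in> S \<and> c \<in> insert b S}\<^sup>*"
    and R: "creach V E \<phi> b R w" and least: "\<And>m. creach V E \<phi> b m w \<Longrightarrow> R \<le> m"
  obtains \<psi> n where "failure_pattern V E t \<psi>" "faulty \<psi> = faulty \<phi>" "creach V E \<psi> v n w"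
    "\<And>m. creach V E \<psi> v m w \<Longrightarrow> R \<le> m"
proof -
  from R obtain p where p: "p 0 = b" "p R = w"
    "\<And>i. i < R \<Longrightarrow> p (Suc i) \<in> nbrs V E (p i) \<and> sends_ok \<phi> (p i) (Suc i) (p (Suc i))"
    by (rule creach_path) blast
  define H where "H = {(y, z). z \<in> nbrs V E y \<and>
    (y \<notin> faulty \<phi> \<or> y \<in> S \<and> z \<in> insert b S \<or> (\<exists>i<R. y = p i \<and> z = p (Suc i)))}"
  obtain \<psi> where \<psi>: "failure_pattern V E t \<psi>" "faulty \<psi> = faulty \<phi>"
    "\<And>n y. creach V E \<psi> v n y \<Longrightarrow> \<exists>m\<le>n. (v, y) \<in> H ^^ m"
    "\<And>y. (v, y) \<in> H\<^sup>* \<Longrightarrow> \<exists>n. creach V E \<psi> v n y"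
    using relay_pattern[OF fp, of H v] by (auto simp: H_def)
  \<comment> \<open>Meeting \<open>p\<close> ahead of time would, by \<open>creach_join\<close>,
    take \<open>s\<close> to \<open>w\<close> in fewer than \<open>R\<close> rounds. Nodes of
    \<open>S\<close> never reach \<open>w\<close>, and for \<open>b\<close> this contradicts
    minimality.\<close>
  have onpath: "i \<le> m" if s: "s \<in> insert b S" "creach V E \<phi> s m (p i)" and "i \<le> R" for s m i
  proof (rule ccontr)
    assume "\<not> i \<le> m"
    then have "creach V E \<phi> s (m + (R - i)) w"
      using creach_join[OF p(3), of R s m i R] s \<open>i \<le> R\<close> p(2) by simp
    then show False using S[of s] least[of "m + (R - i)"] s(1) \<open>\<not> i \<le> m\<close> \<open>i \<le> R\<close> by auto
  qed
  have at: "creach V E \<phi> b i (p i)" if "i \<le> R" for i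
    using creach_join[OF p(3), of R b 0 0 i] p(1) that by simp
  \<comment> \<open>The source \<open>s\<close> may change along the walk: an edge out of a correct
    node extends the old path, entering \<open>insert b S\<close> restarts there with length 0, and
    a hop of \<open>p\<close> switches to \<open>b\<close>, which by \<open>onpath\<close> is no
    later.\<close>
  have inv: "\<exists>s\<in>insert b S. \<exists>m\<le>n. creach V E \<phi> s m y" if "(v, y) \<in> H ^^ n" for n y
    using that
  proof (induction n arbitrary: y)
    case 0
    then show ?case using \<open>v \<in> S\<close> by auto
  next
    case (Suc n)
    then obtain z where "(v, z) \<in> H ^^ n" and zy: "(z, y) \<in> H" by auto
    then obtain s m where s: "s \<in> insert b S" "m \<le> n" "creach V E \<phi> s m z"
      using Suc.IH by blast
    consider "z \<notin> faulty \<phi>" | "y \<in> insert b S" | i where "i < R" "z = p i" "y = p (Suc i)"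
      using zy by (auto simp: H_def)
    then show ?case
    proof cases
      case 1
      then have "creach V E \<phi> s (Suc m) y"
        using s zy by (auto simp: creach_Suc H_def intro: sends_ok_correct)
      then show ?thesis using s by (metis Suc_le_mono)
    next
      case 2
      then show ?thesis by (intro bexI[of _ y] exI[of _ 0]) auto
    next
      case 3
      then have "Suc i \<le> Suc n" using onpath[of s m i] s by auto
      then show ?thesis using at[of "Suc i"] 3 by (metis Suc_leI insertI1)
    qed
  qed
  have "(v, b) \<in> H\<^sup>*" using conn
  proof (induction rule: rtrancl_induct)
    case base
    then show ?case by simp
  next
    case (step y z)
    then have "(y, z) \<in> H" using gr by (auto simp: H_def nbrs_def simple_graph_def)
    then show ?case using step.IH by simp
  qed
  moreover have "(b, p i) \<in> H\<^sup>*" if "i \<le> R" for i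
    using that
  proof (induction i)
    case 0
    then show ?case using p(1) by simp
  next
    case (Suc i)
    then have "(p i, p (Suc i)) \<in> H" using p(3)[of i] unfolding H_def by force
    then show ?case using Suc by (auto intro: rtrancl_into_rtrancl)
  qed
  ultimately have "(v, w) \<in> H\<^sup>*" using p(2) by (metis order_refl rtrancl_trans)
  then obtain n where n: "creach V E \<psi> v n w" using \<psi>(4) by blast
  have "R \<le> m" if m: "creach V E \<psi> v m w" for m
  proof -
    obtain m' where "m' \<le> m" "(v, w) \<in> H ^^ m'" using \<psi>(3) m by blast
    then obtain s k where "s \<in> insert b S" "k \<le> m'" "creach V E \<phi> s k w" using inv by blast
    then show ?thesis using S[of s] least[of k] \<open>m' \<le> m\<close> by auto
  qed
  with \<psi> n show ?thesis using that by blast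
qed

section \<open>Enumeration with connected initial segments\<close>

text \<open>As in a graph search, each new node is adjacent to an earlier one. For
  \<open>k = 0\<close> the relation is empty, so the condition forces
  \<open>L ! 0 = v\<close>.\<close>

lemma connected_enumeration:
  assumes gr: "simple_graph V E" and "graph_connected V E" and "v \<in> V"
  obtains L where "set L = V"
    "\<And>k. k < length L \<Longrightarrow>
       (v, L ! k) \<in> {(a, c). E a c \<and> a \<in> set (take k L) \<and> c \<in> insert (L ! k) (set (take k L))}\<^sup>*"
proof -
  define A where "A L k = {(a, c). E a c \<and> a \<in> set (take k L) \<and> c \<in> insert (L ! k) (set (take k L))}"
    for L k
  have "\<exists>L. length L = n \<and> distinct L \<and> set L \<subseteq> V \<and> (\<forall>k<n. (v, L ! k) \<in> (A L k)\<^sup>*)"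
    if "n \<le> card V" for n
    using that
  proof (induction n)
    case 0
    then show ?case by simp
  next
    case (Suc n)
    then obtain L where L: "length L = n" "distinct L" "set L \<subseteq> V"
      and LA: "\<And>k. k < n \<Longrightarrow> (v, L ! k) \<in> (A L k)\<^sup>*" by auto
    have A_append: "A (L @ [c]) k = A L k" if "k < n" for c k
      using that L(1) by (simp add: A_def nth_append)
    have "\<exists>c. c \<in> V - set L \<and> (v, c) \<in> (A (L @ [c]) n)\<^sup>*"
    proof (cases "n = 0")
      case True
      then show ?thesis using \<open>v \<in> V\<close> L(1) by auto
    next
      case False
      have "L ! 0 = v" using LA[of 0] False by (auto simp: A_def)
      then have v: "v \<in> set L" using False L(1) nth_mem by force
      have "card (set L) < card V" using L(1,2) Suc.prems by (simp add: distinct_card)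
      then obtain y where y: "y \<in> V" "y \<notin> set L" using L(3) by (metis nat_neq_iff subsetI subset_antisym)
      have "(v, y) \<in> {(a, b). E a b}\<^sup>*" using assms y unfolding graph_connected_def by blast
      moreover have "z \<in> set L \<or> (\<exists>a c. E a c \<and> a \<in> set L \<and> c \<notin> set L)"
        if "(v, z) \<in> {(a, b). E a b}\<^sup>*" for z
        using that by (induction rule: rtrancl_induct) (use v in auto)
      ultimately obtain a c where ac: "E a c" "a \<in> set L" "c \<notin> set L" using y by blast
      then obtain j where j: "j < n" "a = L ! j" using L(1) by (auto simp: in_set_conv_nth)
      have "A L j \<subseteq> A (L @ [c]) n"
        using j L(1) by (auto simp: A_def nth_append dest: in_set_takeD)
      then have "(v, a) \<in> (A (L @ [c]) n)\<^sup>*" using LA[OF j(1)] j(2) rtrancl_mono by blast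
      moreover have "(a, c) \<in> A (L @ [c]) n" using ac L(1) by (simp add: A_def nth_append)
      moreover have "c \<in> V" using ac(1) gr by (simp add: simple_graph_def)
      ultimately show ?thesis using ac(3) by (meson DiffI rtrancl_into_rtrancl)
    qed
    then obtain c where c: "c \<in> V - set L" "(v, c) \<in> (A (L @ [c]) n)\<^sup>*" by blast
    then show ?case using L LA
      by (intro exI[of _ "L @ [c]"]) (auto simp: A_append less_Suc_eq nth_append)
  qed
  then obtain L where L: "length L = card V" "distinct L" "set L \<subseteq> V"
    "\<forall>k<card V. (v, L ! k) \<in> (A L k)\<^sup>*" by blast
  then have "set L = V" using gr unfolding simple_graph_def by (metis card_subset_eq distinct_card)
  with L show ?thesis by (intro that[of L]) (auto simp: A_def)
qed

text \<open>Reaching one node of \<open>C\<close> means reaching all of it, so the eccentricity for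
  \<open>(\<phi>, C)\<close> is finite and takes part in the maximum, which exists because finite
  eccentricities are at most \<open>card V\<close>.\<close>

lemma creach_le_ecc_set:
  assumes gr: "simple_graph V E" and "v \<in> V" and fp: "failure_pattern V E t \<phi>"
    and C: "C \<in> comp V E \<phi>" and w: "w \<in> C" "creach V E \<phi> v n w"
  shows "\<exists>m\<le>ecc_set V E (Omega_all V E t) v. creach V E \<phi> v m w"
proof -
  let ?N = "{n. \<exists>(\<phi>, C) \<in> Omega_all V E t. ecc V E \<phi> v C = enat n}"
  have "finite V" using gr by (simp add: simple_graph_def)
  have le: "ecc V E \<chi> v D \<le> enat (card V)"
    if "\<And>y. y \<in> D \<Longrightarrow> \<exists>m. creach V E \<chi> v m y" for \<chi> D
    unfolding ecc_def using that creach_le_card[OF \<open>finite V\<close> \<open>v \<in> V\<close>]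
    by (intro SUP_least) (metis cdist_le_iff)
  have "?N \<subseteq> {..card V}"
  proof
    fix k assume "k \<in> ?N"
    then obtain \<chi> D where k: "ecc V E \<chi> v D = enat k" by auto
    have "cdist V E \<chi> v y \<le> enat k" if "y \<in> D" for y
      using that unfolding k[symmetric] ecc_def by (rule SUP_upper)
    then have "ecc V E \<chi> v D \<le> enat (card V)" by (intro le) (auto simp: cdist_le_iff)
    then show "k \<in> {..card V}" using k by simp
  qed
  then have fin: "finite ?N" by (rule finite_subset) simp
  have "ecc V E \<phi> v C \<le> enat (card V)"
    using creach_comp[OF gr C w(1) _ w(2)] by (intro le) blast
  then obtain k where k: "ecc V E \<phi> v C = enat k" by (cases "ecc V E \<phi> v C") auto
  have "k \<in> ?N" using k fp C by (auto simp: Omega_all_def)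
  then have "k \<le> ecc_set V E (Omega_all V E t) v" unfolding ecc_set_def by (intro Max_ge fin)
  moreover have "cdist V E \<phi> v w \<le> enat k"
    using w(1) unfolding k[symmetric] ecc_def by (rule SUP_upper)
  then have "\<exists>m\<le>k. creach V E \<phi> v m w" by (simp add: cdist_le_iff)
  ultimately show ?thesis by (meson le_trans)
qed

section \<open>The decision rule and its correctness\<close>

theorem theorem2:
  fixes V :: "'v set" and E :: "'v \<Rightarrow> 'v \<Rightarrow> bool" and t :: nat
  assumes "simple_graph V E" and "graph_connected V E"
  shows "\<exists>dec :: 'v \<Rightarrow> ('v \<times> 'x) set \<Rightarrow> 'x.
           oblivious_solves_local_consensus V E t (radius V E t) dec"
proof -
  let ?r = "radius V E t"
  have "finite V" "V \<noteq> {}" using assms by (auto simp: simple_graph_def graph_connected_def)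
  then have "?r \<in> ecc_set V E (Omega_all V E t) ` V" unfolding radius_def by (intro Min_in) auto
  then obtain v where v: "v \<in> V" "?r = ecc_set V E (Omega_all V E t) v" by blast
  obtain L where L: "set L = V" and conn: "\<And>k. k < length L \<Longrightarrow>
       (v, L ! k) \<in> {(a, c). E a c \<and> a \<in> set (take k L) \<and> c \<in> insert (L ! k) (set (take k L))}\<^sup>*"
    by (rule connected_enumeration[OF assms v(1)]) blast
  have hd: "L ! 0 = v" if "0 < length L" using conn[OF that] by simp
  \<comment> \<open>On the view of a node of \<open>V\<close>, \<open>find\<close> succeeds because
    the node sees itself, and \<open>THE\<close> is determined because a view holds one value per
    node.\<close>
  define dec :: "'v \<Rightarrow> ('v \<times> 'x) set \<Rightarrow> 'x" where
    "dec u W = (THE y. (the (find (\<lambda>a. a \<in> fst ` W) L), y) \<in> W)" for u W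
  have heard: "\<exists>m\<le>?r. creach V E \<phi> (L ! k) m w"
    if fp: "failure_pattern V E t \<phi>" and C: "C \<in> comp V E \<phi>" and w: "w \<in> C" and k: "k < length L"
      and "creach V E \<phi> (L ! k) n w"
      and first: "\<And>j n. j < k \<Longrightarrow> \<not> creach V E \<phi> (L ! j) n w" for \<phi> C k n w
  proof (cases "k = 0")
    case True
    then show ?thesis using creach_le_ecc_set[OF assms(1) v(1) fp C w] hd k that(5) v(2) by auto
  next
    case False
    define R where "R = (LEAST n. creach V E \<phi> (L ! k) n w)"
    have R: "creach V E \<phi> (L ! k) R w" unfolding R_def using that(5) by (rule LeastI)
    have "v \<in> set (take k L)" using hd k False by (auto simp: in_set_conv_nth intro!: exI[of _ 0] hd)
    moreover have "\<not> creach V E \<phi> s n w" if "s \<in> set (take k L)" for s n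
      using that first k by (auto simp: in_set_conv_nth)
    moreover have "R \<le> m" if "creach V E \<phi> (L ! k) m w" for m
      using that unfolding R_def by (rule Least_le)
    ultimately obtain \<psi> n where \<psi>: "failure_pattern V E t \<psi>" "faulty \<psi> = faulty \<phi>"
      "creach V E \<psi> v n w" "\<And>m. creach V E \<psi> v m w \<Longrightarrow> R \<le> m"
      using slower_pattern[OF assms(1) fp, of v "set (take k L)" w "L ! k" R] conn[OF k] R by metis
    \<comment> \<open>Components depend only on the set of faulty nodes, so the eccentricity bound
      for \<open>v\<close> applies to \<open>C\<close> under \<open>\<psi>\<close>.\<close>
    have "C \<in> comp V E \<psi>" using C \<psi>(2) by (simp add: comp_def)
    then obtain m where "m \<le> ?r" "creach V E \<psi> v m w"
      using creach_le_ecc_set[OF assms(1) v(1) \<psi>(1) _ w \<psi>(3)] v(2) by auto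
    then show ?thesis using R \<psi>(4) by (meson le_trans)
  qed
  have agree: "\<exists>a\<in>V. \<forall>u\<in>C. dec u (view V E \<phi> x u ?r) = x a"
    if fp: "failure_pattern V E t \<phi>" and C: "C \<in> comp V E \<phi>" and w: "w \<in> C" for \<phi> C w x
  proof -
    \<comment> \<open>Defined through \<open>w\<close>, yet common to all of \<open>C\<close>: by
      \<open>creach_comp\<close> a node reaches all of \<open>C\<close> or none of it.\<close>
    define k where "k = (LEAST k. k < length L \<and> (\<exists>n. creach V E \<phi> (L ! k) n w))"
    have "w \<in> set L" using comp_subset[OF C] w L by auto
    then have "\<exists>k<length L. \<exists>n. creach V E \<phi> (L ! k) n w"
      by (metis creach_0 in_set_conv_nth)
    then have k: "k < length L \<and> (\<exists>n. creach V E \<phi> (L ! k) n w)"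
      unfolding k_def by (rule LeastI_ex)
    have nohear: "\<not> creach V E \<phi> (L ! j) n u" if j: "j < k" and u: "u \<in> C" for j n u
    proof
      assume "creach V E \<phi> (L ! j) n u"
      then obtain m where "creach V E \<phi> (L ! j) m w"
        using creach_comp[OF assms(1) C u w] by blast
      then show False using not_less_Least[OF j[unfolded k_def]] j k by auto
    qed
    have "dec u (view V E \<phi> x u ?r) = x (L ! k)" if u: "u \<in> C" for u
    proof -
      have mem: "a \<in> fst ` view V E \<phi> x u ?r \<longleftrightarrow> (\<exists>m\<le>?r. creach V E \<phi> a m u)" for a
        unfolding Domain_fst[symmetric] Domain_iff mem_view_iff by blast
      obtain n where "creach V E \<phi> (L ! k) n u"
        using creach_comp[OF assms(1) C w u] k by blast
      then have kr: "\<exists>m\<le>?r. creach V E \<phi> (L ! k) m u"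
        using heard[OF fp C u] k nohear[OF _ u] by blast
      then have "find (\<lambda>a. a \<in> fst ` view V E \<phi> x u ?r) L = Some (L ! k)"
        unfolding find_Some_iff mem using k nohear[OF _ u] by (intro exI[of _ k]) auto
      then show ?thesis using kr unfolding dec_def by (auto simp: mem_view_iff)
    qed
    then show ?thesis using k L nth_mem by blast
  qed
  have "oblivious_solves_local_consensus V E t ?r dec"
    unfolding oblivious_solves_local_consensus_def
  proof (intro allI impI conjI ballI)
    fix x :: "'v \<Rightarrow> 'x" and \<phi> assume fp: "failure_pattern V E t \<phi>"
    show "dec u (view V E \<phi> x u ?r) = dec u' (view V E \<phi> x u' ?r)"
      if "C \<in> comp V E \<phi>" "u \<in> C" "u' \<in> C" for C u u'
      using agree[OF fp that(1,2), of x] that by auto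
    show "\<exists>a\<in>V. dec u (view V E \<phi> x u ?r) = x a" if "u \<in> V - faulty \<phi>" for u
    proof -
      have "\<exists>C \<in> comp V E \<phi>. u \<in> C" using that by (auto simp: comp_def Let_def)
      then show ?thesis using agree[OF fp, of _ u x] by blast
    qed
  qed
  then show ?thesis by blast
qed

end
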